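(* For the Lebesgue integral of $f$ over $[0,1]$ the following estimate holds: $$\int_0^1 f(x)\,dx\le\biggl(1-\sum_{n=0}^\infty\frac{u_n}{2+n}\biggr)^{-1}\sum_{n=0}^\infty\frac{r_n}{2+n}.$$
   Context: Let $\mathbb{Z}_0=\{0,1,2,\dots\}$. Every $x\in(0,1]$ has a unique $E$-representation, i.e. there is a unique sequence $(g_n(x))_{n\ge 1}$ of elements of $\mathbb{Z}_0$ with $x=\sum_{n=1}^\infty \frac{1}{(2+g_1)(2+g_1+g_2)\cdots(2+g_1+\dots+g_n)}$, where $g_n=g_n(x)$; this is written $x=\Delta^E_{g_1g_2\ldots g_n\ldots}$. Conversely, every sequence in $\mathbb{Z}_0$ is the $E$-representation of some $x\in(0,1]$. Standing assumptions: $(u_n)_{n\ge0}$ is a sequence of real numbers such that $\sum_{n=0}^\infty u_n$ converges with sum $1$, $|u_n|<1$ for all $n\ge 0$, and $r_n:=\sum_{i=n+1}^\infty u_i=1-(u_0+\dots+u_n)$ satisfies $0<r_n<1$ for all $n\ge0$. The function $f$ is defined on $(0,1]$ by $f(x)=r_{g_1(x)}+\sum_{k=2}^\infty\bigl(r_{g_k(x)}\prod_{i=1}^{k-1}u_{g_i(x)}\bigr)$ (the series converges absolutely), and $f(0):=0$. The series $\sum_n r_n/(2+n)$ has positive terms; if it diverges, its sum is $+\infty$. *)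

theory Defs
  imports "HOL-Analysis.Analysis"
begin

text \<open>Digit sequences are indexed from 0: \<open>g n\<close> is the digit usually written \<open>g\<close> with
  subscript \<open>n + 1\<close>, so the general term below is
  \<open>1 / ((2 + g 0) (2 + g 0 + g 1) \<dots> (2 + g 0 + \<dots> + g n))\<close>.\<close>

definition E_representation :: "(nat \<Rightarrow> nat) \<Rightarrow> real \<Rightarrow> bool" where
  "E_representation g x \<longleftrightarrow>
     (\<lambda>n. 1 / (\<Prod>k\<le>n. 2 + (\<Sum>i\<le>k. real (g i)))) sums x"

text \<open>Meaningful for \<open>0 < x \<le> 1\<close>, where the representation exists and is unique.\<close>

definition E_digits :: "real \<Rightarrow> nat \<Rightarrow> nat" where
  "E_digits x = (THE g. E_representation g x)"

definition tail_sum :: "(nat \<Rightarrow> real) \<Rightarrow> nat \<Rightarrow> real" where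
  "tail_sum u n = (\<Sum>i. u (i + Suc n))"

text \<open>Only the values on \<open>[0, 1]\<close> are meaningful. The summand for \<open>k = 0\<close> is the
  leading term \<open>tail_sum u (E_digits x 0)\<close>, as the product is then empty.\<close>

definition E_function :: "(nat \<Rightarrow> real) \<Rightarrow> real \<Rightarrow> real" where
  "E_function u x =
     (if x = 0 then 0
      else (\<Sum>k. tail_sum u (E_digits x k) * (\<Prod>i<k. u (E_digits x i))))"

end

theory Submission
  imports Defs
begin

text \<open>
  Admit a shifted starting value: for \<open>0 < x \<le> 1 / s\<close> expand \<open>x\<close> with factors
  \<open>s + 1 + g\<^sub>1 + \<dots> + g\<^sub>k\<close> (the case \<open>s = 1\<close> is the \<open>E\<close>-representation). Stripping the first
  digit \<open>n\<close> maps its cylinder affinely onto \<open>(0, 1 / (s + n)]\<close>, so the normalised integrals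
  \<open>K s = s * \<integral> F s\<close> over \<open>(0, 1 / s]\<close> satisfy
  \<open>K s = (\<Sum>n. s * (r\<^sub>n + u\<^sub>n * K (s + n)) / ((s + n) * (s + n + 1)))\<close>, and \<open>0 \<le> K s \<le> 1\<close>.
  The \<open>u\<^sub>n\<close> may be negative, so the termwise estimate of cylinder lengths does not suffice.
  Instead, \<open>r\<^sub>n + u\<^sub>n * K\<close> is a mean of \<open>r\<^sub>n\<close> and \<open>r\<^sub>n\<^sub>-\<^sub>1\<close>, hence between \<open>0\<close> and
  their sum. Using this for \<open>n \<ge> 2\<close> and the exact terms for \<open>n = 0, 1\<close> in the recursions for
  \<open>K 1\<close> and \<open>K 2\<close>, together with summation by parts,
  \<open>1 - (\<Sum>n. u\<^sub>n / (2 + n)) = 1 / 2 + (\<Sum>n. r\<^sub>n / ((2 + n) * (3 + n)))\<close>, reduces the claim to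
  an inequality between finitely many real numbers.
\<close>

subsection \<open>Expansions with a shifted starting value\<close>

definition engel_expansion :: "nat \<Rightarrow> (nat \<Rightarrow> nat) \<Rightarrow> real \<Rightarrow> bool" where
  "engel_expansion s g x \<longleftrightarrow>
     (\<lambda>n. 1 / (\<Prod>k\<le>n. real (s + 1) + (\<Sum>i\<le>k. real (g i)))) sums x"

text \<open>The greedy algorithm: the first digit is the \<open>n\<close> with
  \<open>\<lfloor>1 / x\<rfloor> = s + n\<close>, and the remainder is expanded with start
  \<open>s + n\<close>. Being a total recursion, it also yields digits outside
  \<open>0 < x \<le> 1 / s\<close>, where the truncated subtraction may give
  \<open>0\<close>.\<close>

primrec engel_digits :: "nat \<Rightarrow> real \<Rightarrow> nat \<Rightarrow> nat" where
  "engel_digits s x 0 = nat \<lfloor>1 / x\<rfloor> - s"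
| "engel_digits s x (Suc k) =
     engel_digits (s + (nat \<lfloor>1 / x\<rfloor> - s)) (real (s + (nat \<lfloor>1 / x\<rfloor> - s) + 1) * x - 1) k"

text \<open>Since \<open>x \<le> 1 / s\<close> forces the floor to be at least \<open>s\<close>, the
  subtraction is not truncated, and the cylinders become half-open intervals.\<close>

lemma engel_digit_eq_iff:
  assumes "0 < x" "x \<le> 1 / real s" "0 < s"
  shows "nat \<lfloor>1 / x\<rfloor> - s = n \<longleftrightarrow> 1 / real (s + n + 1) < x \<and> x \<le> 1 / real (s + n)"
proof -
  have "real s \<le> 1 / x" using assms by (simp add: field_simps)
  then have ge: "int s \<le> \<lfloor>1 / x\<rfloor>" by (simp add: le_floor_iff)
  then have "nat \<lfloor>1 / x\<rfloor> - s = n \<longleftrightarrow> \<lfloor>1 / x\<rfloor> = int (s + n)" by linarith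
  also have "\<dots> \<longleftrightarrow> real (s + n) \<le> 1 / x \<and> 1 / x < real (s + n) + 1"
    by (simp add: floor_eq_iff)
  also have "\<dots> \<longleftrightarrow> 1 / real (s + n + 1) < x \<and> x \<le> 1 / real (s + n)"
    using assms by (auto simp: field_simps)
  finally show ?thesis .
qed

lemma engel_shift_bounds:
  assumes "1 / real (s + n + 1) < x" "x \<le> 1 / real (s + n)" "0 < s"
  shows "0 < real (s + n + 1) * x - 1" "real (s + n + 1) * x - 1 \<le> 1 / real (s + n)"
proof -
  show "0 < real (s + n + 1) * x - 1" using assms by (simp add: field_simps)
  have "real (s + n + 1) * x \<le> real (s + n + 1) * (1 / real (s + n))"
    using assms by (intro mult_left_mono) auto
  also have "\<dots> = 1 + 1 / real (s + n)" using assms by (simp add: field_simps)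
  finally show "real (s + n + 1) * x - 1 \<le> 1 / real (s + n)" by simp
qed

text \<open>Every denominator contains the factor \<open>s + 1 + g 0\<close>. Multiplying by it
  leaves 1 plus a series of the same kind with start \<open>s + g 0\<close>.\<close>

lemma engel_expansion_shift:
  "engel_expansion s g x \<longleftrightarrow>
     engel_expansion (s + g 0) (\<lambda>n. g (Suc n)) (real (s + g 0 + 1) * x - 1)"
proof -
  define t where "t = real (s + g 0 + 1)"
  have t: "t > 0" by (simp add: t_def)
  define f where "f n = 1 / (\<Prod>k\<le>n. real (s + 1) + (\<Sum>i\<le>k. real (g i)))" for n
  define f' where "f' n = 1 / (\<Prod>k\<le>n. real (s + g 0 + 1) + (\<Sum>i\<le>k. real (g (Suc i))))" for n
  have f0: "f 0 = 1 / t" by (simp add: f_def t_def add_ac)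
  have fS: "f (Suc n) = (1 / t) * f' n" for n
    unfolding f_def f'_def t_def
    by (subst prod.atMost_Suc_shift, subst sum.atMost_Suc_shift) (simp add: add_ac)
  have "engel_expansion s g x \<longleftrightarrow> f sums ((x - 1 / t) + f 0)"
    unfolding engel_expansion_def f_def[symmetric, abs_def] by (simp add: f0)
  also have "\<dots> \<longleftrightarrow> (\<lambda>n. (1 / t) * f' n) sums ((1 / t) * (t * x - 1))"
    unfolding sums_Suc_iff[symmetric] fS using t by (simp add: field_simps)
  also have "\<dots> \<longleftrightarrow> f' sums (t * x - 1)" using t by (subst sums_mult_iff) auto
  finally show ?thesis unfolding engel_expansion_def f'_def t_def .
qed

section \<open>Uniqueness and existence of expansions\<close>

lemma engel_prod_ge:
  "real (s + 1) ^ Suc n \<le> (\<Prod>k\<le>n. real (s + 1) + (\<Sum>i\<le>k. real (g i)))"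
proof -
  have "(\<Prod>k\<le>n. real (s + 1)) \<le> (\<Prod>k\<le>n. real (s + 1) + (\<Sum>i\<le>k. real (g i)))"
    by (intro prod_mono) (auto intro: sum_nonneg)
  then show ?thesis by simp
qed

lemma engel_prod_pos: "0 < (\<Prod>k\<le>n. real (s + 1) + (\<Sum>i\<le>k. real (g i)))"
  by (intro prod_pos ballI add_pos_nonneg sum_nonneg) auto

text \<open>Comparison with the geometric series of ratio \<open>1 / (s + 1)\<close>, which is the
  expansion with all digits zero and has sum \<open>1 / s\<close>.\<close>

lemma engel_expansion_bounds:
  assumes "engel_expansion s g x" "0 < s"
  shows "0 < x" "x \<le> 1 / real s"
proof -
  define f where "f n = 1 / (\<Prod>k\<le>n. real (s + 1) + (\<Sum>i\<le>k. real (g i)))" for n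
  have f: "f sums x" using assms(1) unfolding engel_expansion_def f_def .
  have pos: "f n > 0" for n using engel_prod_pos by (simp add: f_def)
  then show "0 < x" using f suminf_pos sums_iff by metis
  have "(\<lambda>n. (1 / real (s + 1)) * (1 / real (s + 1)) ^ n) sums
          ((1 / real (s + 1)) * (1 / (1 - 1 / real (s + 1))))"
    using assms by (intro sums_mult geometric_sums) auto
  moreover have "(1 / real (s + 1)) * (1 / (1 - 1 / real (s + 1))) = 1 / real s"
    using assms by (simp add: field_simps)
  ultimately have g: "(\<lambda>n. 1 / real (s + 1) ^ Suc n) sums (1 / real s)"
    by (simp add: power_divide)
  have "f n \<le> 1 / real (s + 1) ^ Suc n" for n
    unfolding f_def by (intro divide_left_mono engel_prod_ge mult_pos_pos engel_prod_pos) auto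
  from sums_le[OF this f g] show "x \<le> 1 / real s" .
qed

text \<open>The shifted expansion obeys the bounds for start \<open>s + g 0\<close>; these place
  \<open>x\<close> in the cylinder of \<open>g 0\<close>, which the greedy algorithm reads
  off.\<close>

lemma engel_expansion_first_digit:
  assumes "engel_expansion s g x" "0 < s"
  shows "nat \<lfloor>1 / x\<rfloor> - s = g 0"
proof -
  have "0 < real (s + g 0 + 1) * x - 1" "real (s + g 0 + 1) * x - 1 \<le> 1 / real (s + g 0)"
    using engel_expansion_bounds[OF assms(1)[unfolded engel_expansion_shift[of s g x]]] assms(2)
    by auto
  then have "1 / real (s + g 0 + 1) < x"
    "real (s + g 0 + 1) * x \<le> real (s + g 0 + 1) * (1 / real (s + g 0))"
    using assms(2) by (auto simp: field_simps)
  then have "1 / real (s + g 0 + 1) < x" "x \<le> 1 / real (s + g 0)"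
    by (auto dest: mult_left_le_imp_le simp del: times_divide_eq_right)
  then show ?thesis
    using engel_digit_eq_iff[of x s "g 0"] engel_expansion_bounds[OF assms] assms(2) by simp
qed

lemma engel_expansion_unique:
  assumes "engel_expansion s g x" "0 < s"
  shows "g k = engel_digits s x k"
  using assms
proof (induction k arbitrary: s g x)
  case 0
  then show ?case using engel_expansion_first_digit by simp
next
  case (Suc k)
  have "g (Suc k) = engel_digits (s + g 0) (real (s + g 0 + 1) * x - 1) k"
    by (rule Suc.IH) (use Suc.prems engel_expansion_shift[of s g x] in auto)
  then show ?case using engel_expansion_first_digit[OF Suc.prems] by simp
qed

text \<open>The numerator \<open>y\<close> is the iterated shift of \<open>x\<close>; each shift
  stays below the reciprocal of its starting value, hence below 1. A bounded numerator makes the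
  error vanish as the denominators grow.\<close>

lemma engel_remainder:
  assumes "0 < x" "x \<le> 1 / real s" "0 < s"
  shows "\<exists>y. 0 < y \<and> y \<le> 1 \<and>
    x - (\<Sum>j\<le>n. 1 / (\<Prod>k\<le>j. real (s + 1) + (\<Sum>i\<le>k. real (engel_digits s x i))))
      = y / (\<Prod>k\<le>n. real (s + 1) + (\<Sum>i\<le>k. real (engel_digits s x i)))"
  using assms
proof (induction n arbitrary: s x)
  case 0
  let ?d = "nat \<lfloor>1 / x\<rfloor> - s"
  let ?y = "real (s + ?d + 1) * x - 1"
  have d: "1 / real (s + ?d + 1) < x" "x \<le> 1 / real (s + ?d)"
    using engel_digit_eq_iff[OF 0] by blast+
  have y: "0 < ?y" "?y \<le> 1 / real (s + ?d)" using engel_shift_bounds[OF d 0(3)] .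
  have "1 / real (s + ?d) \<le> 1" using 0 by simp
  then have "?y \<le> 1" using y(2) by linarith
  moreover have "x - 1 / (real (s + ?d + 1)) = ?y / (real (s + ?d + 1))"
    by (simp add: field_simps del: of_nat_diff)
  ultimately show ?case using y(1) by (intro exI[of _ ?y]) (simp add: add_ac)
next
  case (Suc n)
  let ?d = "nat \<lfloor>1 / x\<rfloor> - s"
  let ?y = "real (s + ?d + 1) * x - 1"
  have d: "1 / real (s + ?d + 1) < x" "x \<le> 1 / real (s + ?d)"
    using engel_digit_eq_iff[OF Suc.prems] by blast+
  have y: "0 < ?y" "?y \<le> 1 / real (s + ?d)" using engel_shift_bounds[OF d Suc.prems(3)] .
  define t where "t = real (s + ?d + 1)"
  have t: "t > 0" by (simp add: t_def)
  define P where "P = (\<lambda>n. \<Prod>k\<le>n. real (s + 1) + (\<Sum>i\<le>k. real (engel_digits s x i)))"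
  define Q where "Q = (\<lambda>n. \<Prod>k\<le>n. real (s + ?d + 1) + (\<Sum>i\<le>k. real (engel_digits (s + ?d) ?y i)))"
  have P0: "P 0 = t" by (simp add: P_def t_def add_ac)
  have PS: "P (Suc n) = t * Q n" for n
    unfolding P_def Q_def t_def
    by (subst prod.atMost_Suc_shift, subst sum.atMost_Suc_shift) (simp add: add_ac)
  obtain z where z: "0 < z" "z \<le> 1" "?y - (\<Sum>j\<le>n. 1 / Q j) = z / Q n"
    using Suc.IH[OF y] Suc.prems(3) unfolding Q_def by auto
  have "(\<Sum>j\<le>Suc n. 1 / P j) = 1 / t + (\<Sum>j\<le>n. 1 / Q j) / t"
    by (subst sum.atMost_Suc_shift) (simp add: P0 PS sum_divide_distrib mult.commute)
  moreover have "x - (1 / t + q / t) = (t * x - 1 - q) / t" for q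
    using t by (simp add: field_simps)
  ultimately have "x - (\<Sum>j\<le>Suc n. 1 / P j) = (?y - (\<Sum>j\<le>n. 1 / Q j)) / t"
    by (simp only: t_def)
  also have "\<dots> = z / P (Suc n)" unfolding z(3) PS by simp
  finally show ?case using z unfolding P_def by auto
qed

lemma engel_expansion_exists:
  assumes "0 < x" "x \<le> 1 / real s" "0 < s"
  shows "engel_expansion s (engel_digits s x) x"
proof -
  define P where "P = (\<lambda>n. \<Prod>k\<le>n. real (s + 1) + (\<Sum>i\<le>k. real (engel_digits s x i)))"
  have P: "P n > 0" "2 ^ n \<le> P n" for n
  proof -
    show "P n > 0" unfolding P_def by (rule engel_prod_pos)
    have "(2::real) ^ n \<le> 2 ^ Suc n" by simp
    also have "\<dots> \<le> real (s + 1) ^ Suc n" using assms(3) by (intro power_mono) auto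
    also have "\<dots> \<le> P n" unfolding P_def by (rule engel_prod_ge)
    finally show "2 ^ n \<le> P n" .
  qed
  have le: "norm ((\<Sum>j\<le>n. 1 / P j) - x) \<le> (1 / 2) ^ n" for n
  proof -
    obtain y where y: "0 < y" "y \<le> 1" "x - (\<Sum>j\<le>n. 1 / P j) = y / P n"
      using engel_remainder[OF assms] unfolding P_def by blast
    have "norm ((\<Sum>j\<le>n. 1 / P j) - x) = y / P n"
      using y P(1)[of n] by (simp add: abs_minus_commute[of _ x])
    also have "\<dots> \<le> 1 / 2 ^ n" using y P[of n] by (intro frac_le) auto
    finally show ?thesis by (simp add: power_divide)
  qed
  have "(\<lambda>n. (\<Sum>j\<le>n. 1 / P j) - x) \<longlonglongrightarrow> 0"
    by (rule Lim_null_comparison[OF always_eventually[OF allI[OF le]]]) (intro LIMSEQ_power_zero, simp)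
  then have "(\<lambda>n. 1 / P n) sums x" unfolding sums_def_le by (rule LIM_zero_cancel)
  then show ?thesis unfolding engel_expansion_def P_def .
qed

section \<open>Identification and measurability of the digits\<close>

lemma E_digits_eq:
  assumes "0 < x" "x \<le> 1"
  shows "E_digits x = engel_digits 1 x"
proof -
  have eq: "E_representation g x \<longleftrightarrow> engel_expansion 1 g x" for g
    by (simp add: E_representation_def engel_expansion_def)
  show ?thesis
    unfolding E_digits_def eq
  proof (rule the_equality)
    show "engel_expansion 1 (engel_digits 1 x) x" using engel_expansion_exists[of x 1] assms by simp
    show "g = engel_digits 1 x" if "engel_expansion 1 g x" for g
      using engel_expansion_unique[OF that] by auto
  qed
qed

lemma measurable_engel_digits:
  "(\<lambda>x. engel_digits s x k) \<in> borel \<rightarrow>\<^sub>M count_space UNIV"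
proof (induction k arbitrary: s)
  case 0
  show ?case by simp
next
  case (Suc k)
  have IH[measurable]: "(\<lambda>x. engel_digits (s + n) (real (s + n + 1) * x - 1) k)
      \<in> borel \<rightarrow>\<^sub>M count_space UNIV" for n
    by (rule measurable_compose[OF _ Suc]) simp
  \<comment> \<open>The inner function is indexed by the first digit. As that takes countably many
    values, measurability for each fixed \<open>n\<close> suffices.\<close>
  have "(\<lambda>x. (\<lambda>n. engel_digits (s + n) (real (s + n + 1) * x - 1) k) (nat \<lfloor>1 / x\<rfloor> - s))
      \<in> borel \<rightarrow>\<^sub>M count_space UNIV"
    by (rule measurable_compose_countable[OF IH]) simp
  then show ?case by simp
qed

subsection \<open>The recursion for the integrals\<close>

locale signed_digit_weights =
  fixes u :: "nat \<Rightarrow> real"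
  assumes u_sums: "u sums 1"
    and u_less_1: "\<bar>u n\<bar> < 1"
    and tail_pos: "0 < tail_sum u n"
    and tail_less_1: "tail_sum u n < 1"
begin

section \<open>The series for a general starting value and its bounds\<close>

abbreviation "r \<equiv> tail_sum u"

definition F :: "nat \<Rightarrow> real \<Rightarrow> real" where
  "F s x = (\<Sum>k. r (engel_digits s x k) * (\<Prod>i<k. u (engel_digits s x i)))"

lemma tail_sum_eq: "r n = 1 - (\<Sum>i\<le>n. u i)"
proof -
  have "(\<lambda>i. u (i + Suc n)) sums (1 - (\<Sum>i<Suc n. u i))"
    using u_sums by (rule sums_split_initial_segment)
  then show ?thesis by (simp add: tail_sum_def sums_iff lessThan_Suc_atMost)
qed

lemma u_0: "u 0 = 1 - r 0"
  by (simp add: tail_sum_eq)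

lemma u_Suc: "u (Suc n) = r n - r (Suc n)"
  by (simp add: tail_sum_eq)

lemma tail_sum_tendsto_0: "r \<longlonglongrightarrow> 0"
proof -
  have "(\<lambda>n. 1 - (\<Sum>i\<le>n. u i)) \<longlonglongrightarrow> 1 - 1"
    using u_sums unfolding sums_def_le by (intro tendsto_intros)
  then show ?thesis by (simp add: tail_sum_eq[abs_def])
qed

text \<open>As \<open>u\<close> tends to 0, only finitely many terms reach \<open>1 / 2\<close> in
  modulus, and their maximum is below 1. The gap to 1 provides geometric majorants.\<close>

lemma u_uniform_bound: "\<exists>q. 0 < q \<and> q < 1 \<and> (\<forall>n. \<bar>u n\<bar> \<le> q)"
proof -
  have "u \<longlonglongrightarrow> 0" using u_sums summable_LIMSEQ_zero sums_summable by blast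
  then obtain N where N: "\<And>n. n \<ge> N \<Longrightarrow> \<bar>u n\<bar> < 1 / 2"
    using LIMSEQ_D[of u 0 "1 / 2"] by auto
  define q where "q = Max (insert (1 / 2) ((\<lambda>n. \<bar>u n\<bar>) ` {..<N}))"
  have "1 / 2 \<le> q" unfolding q_def by (rule Max_ge) auto
  moreover have "q < 1" using u_less_1 by (simp add: q_def)
  moreover have "\<bar>u n\<bar> \<le> q" for n
  proof (cases "n < N")
    case True
    then show ?thesis by (simp add: q_def Max_ge)
  next
    case False
    then have "\<bar>u n\<bar> < 1 / 2" using N by simp
    then show ?thesis using \<open>1 / 2 \<le> q\<close> by linarith
  qed
  ultimately show ?thesis by (intro exI[of _ q]) auto
qed

lemma F_term_bound:
  assumes "\<And>n. \<bar>u n\<bar> \<le> q"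
  shows "norm (r (g k) * (\<Prod>i<k. u (g i))) \<le> q ^ k"
proof -
  have "\<bar>\<Prod>i<k. u (g i)\<bar> \<le> (\<Prod>i<k. q)"
    unfolding abs_prod by (intro prod_mono) (simp add: assms)
  then have "\<bar>r (g k)\<bar> * \<bar>\<Prod>i<k. u (g i)\<bar> \<le> 1 * (\<Prod>i<k. q)"
    using tail_pos[of "g k"] tail_less_1[of "g k"] by (intro mult_mono) auto
  then show ?thesis by (simp add: abs_mult)
qed

lemma summable_F_terms: "summable (\<lambda>k. r (g k) * (\<Prod>i<k. u (g i)))"
proof -
  obtain q where q: "0 < q" "q < 1" "\<And>n. \<bar>u n\<bar> \<le> q" using u_uniform_bound by blast
  show ?thesis
    by (rule summable_comparison_test[where g = "\<lambda>k. q ^ k"])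
      (use F_term_bound[OF q(3)] q in \<open>auto intro: summable_geometric\<close>)
qed

text \<open>The first term splits off and \<open>u n\<close> is a common factor of the others. The
  identity holds for every real \<open>x\<close>, so it can be iterated freely.\<close>

lemma F_rec:
  assumes "nat \<lfloor>1 / x\<rfloor> - s = n"
  shows "F s x = r n + u n * F (s + n) (real (s + n + 1) * x - 1)"
proof -
  have *: "engel_digits s x 0 = n"
    "\<And>k. engel_digits s x (Suc k) = engel_digits (s + n) (real (s + n + 1) * x - 1) k"
    using assms by auto
  have "F s x = (\<Sum>k. r (engel_digits s x (Suc k)) * (\<Prod>i<Suc k. u (engel_digits s x i))) + r n"
    unfolding F_def suminf_split_head[OF summable_F_terms] by (simp add: *(1) del: engel_digits.simps)
  also have "\<dots> = (\<Sum>k. u n * (r (engel_digits (s + n) (real (s + n + 1) * x - 1) k) *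
      (\<Prod>i<k. u (engel_digits (s + n) (real (s + n + 1) * x - 1) i)))) + r n"
    unfolding * prod.lessThan_Suc_shift by (simp only: mult_ac)
  also have "\<dots> = u n * F (s + n) (real (s + n + 1) * x - 1) + r n"
    unfolding F_def by (subst suminf_mult[OF summable_F_terms]) simp
  finally show ?thesis by simp
qed

text \<open>Since \<open>u n\<close> is a difference of consecutive tails (with \<open>r (-1) = 1\<close>), the value
  \<open>r n + u n * t\<close> is a convex combination of \<open>r n\<close> and \<open>r (n - 1)\<close> for \<open>0 \<le> t \<le> 1\<close>,
  whatever the sign of \<open>u n\<close>.\<close>

lemma affine_bounds:
  assumes "0 \<le> t" "t \<le> 1"
  shows "0 \<le> r n + u n * t" "r n + u n * t \<le> 1"
    "r (Suc m) + u (Suc m) * t \<le> r m + r (Suc m)"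
proof -
  define p where "p = (case n of 0 \<Rightarrow> 1 | Suc m \<Rightarrow> r m)"
  have p: "0 \<le> p" "p \<le> 1" "r n + u n * t = (1 - t) * r n + t * p"
    using tail_pos tail_less_1
    by (auto simp: p_def u_0 u_Suc algebra_simps less_imp_le split: nat.split)
  show "0 \<le> r n + u n * t"
    using p assms tail_pos[of n] by simp
  have "(1 - t) * r n + t * p \<le> (1 - t) * 1 + t * 1"
    using p assms tail_less_1[of n] by (intro add_mono mult_left_mono) auto
  then show "r n + u n * t \<le> 1" using p by simp
  have "(1 - t) * r (Suc m) + t * r m \<le> 1 * r (Suc m) + 1 * r m"
    using assms tail_pos[of "Suc m"] tail_pos[of m] by (intro add_mono mult_right_mono) auto
  then show "r (Suc m) + u (Suc m) * t \<le> r m + r (Suc m)" by (simp add: u_Suc algebra_simps)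
qed

text \<open>By \<open>affine_bounds\<close>, the maps \<open>t \<mapsto> r n + u n * t\<close> send
  \<open>[0, 1]\<close> into itself, and they contract distances by \<open>q\<close>. Iterating
  \<open>F_rec\<close> therefore improves the crude bound \<open>M\<close> to a distance of at most
  \<open>q ^ N * M\<close> from \<open>[0, 1]\<close>.\<close>

lemma F_bounds: "0 \<le> F s x" "F s x \<le> 1"
proof -
  obtain q where q: "0 < q" "q < 1" "\<And>n. \<bar>u n\<bar> \<le> q" using u_uniform_bound by blast
  define M where "M = 1 / (1 - q)"
  have M: "M \<ge> 0" using q by (simp add: M_def)
  have crude: "\<bar>F s x\<bar> \<le> M" for s x
  proof -
    have "norm (F s x) \<le> (\<Sum>k. q ^ k)"
      unfolding F_def
      by (rule norm_suminf_le[OF F_term_bound[OF q(3)]]) (use q in \<open>auto intro: summable_geometric\<close>)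
    then show ?thesis using q by (simp add: M_def suminf_geometric)
  qed
  have approx: "- (q ^ N * M) \<le> F s x \<and> F s x \<le> 1 + q ^ N * M" for N
  proof (induction N arbitrary: s x)
    case 0
    show ?case using crude[of s x] by auto
  next
    case (Suc N)
    define n where "n = nat \<lfloor>1 / x\<rfloor> - s"
    define v where "v = F (s + n) (real (s + n + 1) * x - 1)"
    \<comment> \<open>The point of \<open>[0, 1]\<close> nearest to \<open>v\<close>; by induction
      it is within \<open>q ^ N * M\<close> of \<open>v\<close>.\<close>
    define t where "t = max 0 (min 1 v)"
    have "0 \<le> q ^ N * M" using M q by simp
    then have v: "\<bar>v - t\<bar> \<le> q ^ N * M" and t: "0 \<le> t" "t \<le> 1"
      using Suc[of "s + n" "real (s + n + 1) * x - 1"] unfolding v_def[symmetric] t_def by linarith+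
    have "\<bar>u n * (v - t)\<bar> \<le> q * (q ^ N * M)"
      unfolding abs_mult using v q by (intro mult_mono) auto
    moreover have "F s x = (r n + u n * t) + u n * (v - t)"
      using F_rec[of x s n] by (simp add: n_def v_def algebra_simps)
    ultimately show ?case using affine_bounds(1,2)[OF t, of n] by (auto simp: abs_le_iff mult_ac)
  qed
  have lim: "(\<lambda>N. q ^ N * M) \<longlonglongrightarrow> 0"
    using q by (intro tendsto_mult_left_zero LIMSEQ_power_zero) auto
  have "(\<lambda>N. - (q ^ N * M)) \<longlonglongrightarrow> - 0" "(\<lambda>N. 1 + q ^ N * M) \<longlonglongrightarrow> 1 + 0"
    by (intro tendsto_intros lim)+
  then show "0 \<le> F s x" "F s x \<le> 1"
    using approx by (auto intro: LIMSEQ_le_const LIMSEQ_le_const2)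
qed

section \<open>Integrals over cylinders and the recursion for \<open>K\<close>\<close>

lemma measurable_F [measurable]: "F s \<in> borel_measurable borel"
proof -
  have [measurable]: "(\<lambda>x. h (engel_digits s x k)) \<in> borel_measurable borel" for h :: "nat \<Rightarrow> real" and k
    by (rule measurable_compose[OF measurable_engel_digits]) simp
  show ?thesis unfolding F_def[abs_def] by measurable
qed

lemma set_integrable_F: "set_integrable lborel {a<..b} (F s)"
  unfolding set_integrable_def
proof (rule integrableI_bounded_set_indicator[where B = 1])
  show "emeasure lborel {a<..b} < \<infinity>" by (cases "a \<le> b") auto
  show "AE x in lborel. x \<in> {a<..b} \<longrightarrow> norm (F s x) \<le> 1" using F_bounds by auto
qed auto

definition K :: "nat \<Rightarrow> real" where
  "K s = real s * (LINT x:{0<..1 / real s}|lborel. F s x)"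

lemma set_integral_F_bounds:
  assumes "a \<le> b"
  shows "0 \<le> (LINT x:{a<..b}|lborel. F s x)" "(LINT x:{a<..b}|lborel. F s x) \<le> b - a"
proof -
  show "0 \<le> (LINT x:{a<..b}|lborel. F s x)"
    unfolding set_lebesgue_integral_def by (intro integral_nonneg_AE) (auto simp: F_bounds)
  have "(LINT x:{a<..b}|lborel. F s x) \<le> (LINT x:{a<..b}|lborel. 1)"
    by (rule set_integral_mono[OF set_integrable_F]) (use assms F_bounds in \<open>auto simp: set_integrable_def\<close>)
  also have "\<dots> = b - a" using assms by (simp add: set_lebesgue_integral_def)
  finally show "(LINT x:{a<..b}|lborel. F s x) \<le> b - a" .
qed

lemma K_bounds:
  assumes "0 < s"
  shows "0 \<le> K s" "K s \<le> 1"
proof -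
  show "0 \<le> K s" unfolding K_def using set_integral_F_bounds(1) by simp
  have "K s \<le> real s * (1 / real s - 0)"
    unfolding K_def by (intro mult_left_mono set_integral_F_bounds) auto
  then show "K s \<le> 1" using assms by simp
qed

text \<open>The substitution \<open>y = (s + n + 1) * x - 1\<close> in \<open>F_rec\<close> leads to
  the interval of \<open>K (s + n)\<close>. The Jacobian and the normalisation of \<open>K\<close>
  contribute the two factors of the denominator.\<close>

lemma integral_F_cylinder:
  assumes "0 < s"
  shows "(LINT x:{1 / real (s + n + 1)<..1 / real (s + n)}|lborel. F s x)
    = (r n + u n * K (s + n)) / (real (s + n) * real (s + n + 1))"
proof -
  define m where "m = s + n"
  have m: "0 < real m" using assms by (simp add: m_def)
  \<comment> \<open>The indicator is part of \<open>?G\<close>, so the affine substitution takes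
    place on the whole line; \<open>ind\<close> matches the two indicators.\<close>
  let ?G = "\<lambda>y. indicator {0<..1 / real m} y *\<^sub>R (r n + u n * F m y)"
  have ind: "x \<in> {1 / real (m + 1)<..1 / real m} \<longleftrightarrow> -1 + real (m + 1) * x \<in> {0<..1 / real m}" for x
  proof -
    have "x \<le> 1 / real m \<longleftrightarrow> real (m + 1) * x \<le> real (m + 1) * (1 / real m)"
      by (subst mult_le_cancel_left_pos) auto
    also have "real (m + 1) * (1 / real m) = 1 + 1 / real m" using m by (simp add: field_simps)
    finally show ?thesis by (auto simp: field_simps)
  qed
  have "(LINT x:{1 / real (m + 1)<..1 / real m}|lborel. F s x)
      = (LINT x|lborel. ?G (-1 + real (m + 1) * x))"
    unfolding set_lebesgue_integral_def
  proof (rule Bochner_Integration.integral_cong[OF refl])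
    fix x
    show "indicator {1 / real (m + 1)<..1 / real m} x *\<^sub>R F s x = ?G (-1 + real (m + 1) * x)"
    proof (cases "x \<in> {1 / real (m + 1)<..1 / real m}")
      case True
      then have *: "0 < x" "x \<le> 1 / real s"
      proof -
        have "0 < 1 / real (m + 1)" by simp
        also have "\<dots> < x" using True by simp
        finally show "0 < x" .
        have "1 / real m \<le> 1 / real s" using assms by (intro frac_le) (auto simp: m_def)
        then show "x \<le> 1 / real s" using True by auto
      qed
      have "nat \<lfloor>1 / x\<rfloor> - s = n"
        using engel_digit_eq_iff[OF * assms] True by (simp add: m_def)
      then have "F s x = r n + u n * F m (-1 + real (m + 1) * x)"
        by (subst F_rec) (simp_all add: m_def)
      then show ?thesis using True ind[of x] by (simp del: of_nat_add)
    next
      case False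
      then have "-1 + real (m + 1) * x \<notin> {0<..1 / real m}" using ind by blast
      with False show ?thesis by (simp only: indicator_simps(2) scaleR_zero_left not_False_eq_True)
    qed
  qed
  also have "\<dots> = (LINT y|lborel. ?G y) / real (m + 1)"
    using lborel_integral_real_affine[of "real (m + 1)" ?G "-1"] by simp
  also have "(LINT y|lborel. ?G y) = (LINT y:{0<..1 / real m}|lborel. r n)
      + (LINT y:{0<..1 / real m}|lborel. u n * F m y)"
    using set_integral_add(2)[of lborel "{0<..1 / real m}" "\<lambda>_. r n" "\<lambda>y. u n * F m y"]
      set_integrable_mult_right[OF set_integrable_F]
    by (simp add: set_lebesgue_integral_def set_integrable_def)
  also have "\<dots> = (r n + u n * K m) / real m"
    using m by (simp add: set_lebesgue_integral_def K_def add_divide_distrib)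
  finally show ?thesis by (simp add: m_def)
qed

text \<open>The cylinders exhaust the interval: partial sums telescope, and since \<open>F\<close>
  lies in \<open>[0, 1]\<close>, the integral left over near 0 is at most the length
  \<open>1 / (s + N)\<close>.\<close>

lemma K_sums:
  assumes "0 < s"
  shows "(\<lambda>n. real s * (r n + u n * K (s + n)) / (real (s + n) * real (s + n + 1))) sums K s"
proof -
  define c where "c = (\<lambda>n. (r n + u n * K (s + n)) / (real (s + n) * real (s + n + 1)))"
  define R where "R = (\<lambda>N. LINT x:{0<..1 / real (s + N)}|lborel. F s x)"
  have step: "R N = c N + R (Suc N)" for N
  proof -
    have le: "1 / real (s + N + 1) \<le> 1 / real (s + N)"
      using assms by (intro frac_le) auto
    have un: "{0<..1 / real (s + N)} = {0<..1 / real (s + N + 1)} \<union> {1 / real (s + N + 1)<..1 / real (s + N)}"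
      using le by (intro ivl_disj_un_two(6)[symmetric]) (auto simp del: of_nat_add)
    have "(LINT x:{1 / real (s + N + 1)<..1 / real (s + N)}|lborel. F s x) = c N"
      unfolding c_def by (rule integral_F_cylinder[OF assms])
    then show ?thesis
      unfolding R_def un
      by (subst set_integral_Un[OF _ set_integrable_F set_integrable_F])
        (auto simp del: of_nat_add)
  qed
  have part: "(\<Sum>n<N. c n) = R 0 - R N" for N
  proof (induction N)
    case (Suc N)
    then show ?case using step[of N] by simp
  qed simp
  have "\<bar>R N\<bar> \<le> 1 / real (s + N)" for N
    using set_integral_F_bounds[of 0 "1 / real (s + N)" s] by (simp add: R_def)
  moreover have "(\<lambda>N. 1 / real (s + N)) \<longlonglongrightarrow> 0"
    using LIMSEQ_ignore_initial_segment[OF lim_1_over_n[where 'a = real], of s] by (simp add: add.commute)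
  ultimately have "R \<longlonglongrightarrow> 0" by (intro Lim_null_comparison[of R]) auto
  then have "(\<lambda>N. R 0 - R N) \<longlonglongrightarrow> R 0 - 0" by (intro tendsto_intros)
  then have "c sums R 0" by (simp add: sums_def part)
  then have "(\<lambda>n. real s * c n) sums (real s * R 0)" by (rule sums_mult)
  then show ?thesis by (simp add: c_def R_def K_def)
qed

end

subsection \<open>The estimate\<close>

lemma summable_split_two:
  fixes g :: "nat \<Rightarrow> real"
  assumes "summable g"
  shows "suminf g = g 0 + g 1 + (\<Sum>n. g (n + 2))"
  using suminf_split_initial_segment[OF assms, of 2] by (simp add: numeral_2_eq_2)

text \<open>Here \<open>I\<close>, \<open>E\<close>, \<open>L\<close> stand for \<open>K 1\<close>, \<open>K 2\<close>, \<open>K 3\<close> and \<open>a\<close>, \<open>b\<close> for the first two tails.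
  The crude bound \<open>E \<le> 1\<close> would not suffice for small \<open>a\<close>, hence the use of \<open>E_eq\<close>.\<close>

lemma two_step_estimate:
  fixes a b I E L T1 T2 V W :: real
  assumes a: "0 < a" "a < 1" and b: "0 < b" and I: "0 \<le> I" "I \<le> 1" and E: "0 \<le> E" "E \<le> 1"
    and L: "0 \<le> L" "L \<le> 1" and T1: "0 \<le> T1" "T1 \<le> b / 12 + 4 * W / 15"
    and T2: "0 \<le> T2" "T2 \<le> b / 10 + W / 3" and W: "0 \<le> W" and V: "V \<le> W / 5"
    and I_eq: "I = (a + (1 - a) * I) / 2 + (b + (a - b) * E) / 6 + T1"
    and E_eq: "E = (a + (1 - a) * E) / 3 + (b + (a - b) * L) / 6 + T2"
  shows "I * (1 + a / 3 + b / 6 + V) \<le> a + 2 * b / 3 + W"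
proof -
  define p where "p = b + (a - b) * E"
  define q where "q = b + (a - b) * L"
  have convex: "b + (a - b) * t = b * (1 - t) + a * t" for t by (simp add: algebra_simps)
  have p: "0 \<le> p" unfolding p_def convex using a b E by auto
  have q: "0 \<le> q" unfolding q_def convex using a b L by auto
  have "b * (1 - L) + a * L \<le> b * 1 + a * 1" using a b L by (intro add_mono mult_left_mono) auto
  then have q': "q \<le> a + b" unfolding q_def convex by simp
  have I1: "I * (1 + a) = a + p / 3 + 2 * T1"
  proof -
    have "I * (1 + a) = 2 * I - (1 - a) * I" by (simp add: algebra_simps)
    moreover have "2 * I = a + (1 - a) * I + p / 3 + 2 * T1" using I_eq[folded p_def] by argo
    ultimately show ?thesis by simp
  qed
  have E1: "E * (2 + a) = a + q / 2 + 3 * T2"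
  proof -
    have "E * (2 + a) = 3 * E - (1 - a) * E" by (simp add: algebra_simps)
    moreover have "3 * E = a + (1 - a) * E + q / 2 + 3 * T2" using E_eq[folded q_def] by argo
    ultimately show ?thesis by simp
  qed
  \<comment> \<open>The upper bound adds \<open>q / 2 \<le> (a + b) / 2\<close> and
    \<open>3 * T2 \<le> 3 * b / 10 + W\<close> to \<open>a\<close>.\<close>
  have E_ge: "a \<le> E * (2 + a)" and E_le: "E * (2 + a) \<le> 3 * a / 2 + 4 * b / 5 + W"
    using E1 T2 q q' by linarith+
  have I_ge: "a \<le> 2 * I"
  proof -
    have "a \<le> I * (1 + a)" using I1 T1 p by linarith
    also have "\<dots> \<le> I * 2" using I a by (intro mult_left_mono) auto
    finally show ?thesis by simp
  qed
  \<comment> \<open>The final step spends \<open>8 / 15 * W\<close> on \<open>2 * T1\<close> and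
    \<open>W / 5\<close> on \<open>I * V\<close>; a third of the present bound is exactly the
    remaining \<open>4 / 15 * W\<close>. After multiplication by \<open>2 + a\<close>,
    \<open>E_le\<close>, \<open>E_ge\<close> and \<open>I_ge\<close> apply, and the quadratic terms
    left over, \<open>- (a * a) / 2 - (a * b) / 5\<close>, are negative.\<close>
  have key: "(a - b) * E - 2 * (a * I) \<le> 4 / 5 * W"
  proof -
    have "a * (E * (2 + a)) \<le> a * (3 * a / 2 + 4 * b / 5 + W)"
      using E_le a by (intro mult_left_mono) auto
    moreover have "b * a \<le> b * (E * (2 + a))" using E_ge b by (intro mult_left_mono) auto
    moreover have "a * 2 * a \<le> a * (2 + a) * (2 * I)" using I_ge a by (intro mult_mono) auto
    moreover have "a * W \<le> 1 * W" using a W by (intro mult_right_mono) auto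
    moreover have "0 \<le> a * W" using a W by simp
    moreover have "0 \<le> a * a" "0 \<le> a * b" using a b by auto
    moreover have "(2 + a) * ((a - b) * E - 2 * (a * I))
        = a * (E * (2 + a)) - b * (E * (2 + a)) - a * (2 + a) * (2 * I)"
      by (simp add: algebra_simps)
    moreover have "a * (3 * a / 2 + 4 * b / 5 + W) - b * a - a * 2 * a
        = a * W - (a * a) / 2 - (a * b) / 5"
      by (simp add: field_simps)
    moreover have "(2 + a) * (4 / 5 * W) = 8 / 5 * W + 4 / 5 * (a * W)"
      by (simp add: algebra_simps)
    ultimately have "(2 + a) * ((a - b) * E - 2 * (a * I)) \<le> (2 + a) * (4 / 5 * W)"
      by linarith
    then show ?thesis using a by (simp only: mult_le_cancel_left_pos)
  qed
  have "I * (1 + a / 3 + b / 6 + V) = I * (1 + a) - 2 / 3 * (a * I) + I * (b / 6) + I * V"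
    by (simp add: algebra_simps)
  moreover have "I * (b / 6) \<le> 1 * (b / 6)" using I b by (intro mult_right_mono) auto
  moreover have "I * V \<le> I * (W / 5)" using I V by (intro mult_left_mono) auto
  moreover have "I * (W / 5) \<le> 1 * (W / 5)" using I W by (intro mult_right_mono) auto
  ultimately show ?thesis
    using key T1 I1 p_def by linarith
qed

section \<open>Summation by parts\<close>

context signed_digit_weights
begin

text \<open>As the tails lie in \<open>(0, 1)\<close>, a telescoping series dominates; convergence
  thus holds even if the sum of \<open>r n / (2 + n)\<close> diverges.\<close>

lemma summable_tail_products:
  "summable (\<lambda>n. r n / ((2 + real n) * (3 + real n)))"
proof (rule summable_comparison_test)
  have "(\<lambda>n. 1 / real (n + 2)) \<longlonglongrightarrow> 0"
    using LIMSEQ_ignore_initial_segment[OF lim_1_over_n[where 'a = real], of 2] .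
  from telescope_sums'[OF this]
  show "summable (\<lambda>n. 1 / real (n + 2) - 1 / real (Suc n + 2))" by (rule sums_summable)
  have "norm (r n / ((2 + real n) * (3 + real n))) \<le> 1 / real (n + 2) - 1 / real (Suc n + 2)" for n
  proof -
    have "1 / real (n + 2) - 1 / real (Suc n + 2) = 1 / ((2 + real n) * (3 + real n))"
      by (simp add: field_simps)
    moreover have "r n / ((2 + real n) * (3 + real n)) \<le> 1 / ((2 + real n) * (3 + real n))"
      using tail_less_1[of n] by (intro divide_right_mono) auto
    ultimately show ?thesis using tail_pos[of n] by simp
  qed
  then show "\<exists>N. \<forall>n\<ge>N. norm (r n / ((2 + real n) * (3 + real n)))
      \<le> 1 / real (n + 2) - 1 / real (Suc n + 2)" by blast
qed

lemma weighted_sum_by_parts: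
  "(\<lambda>n. u n / (2 + real n)) sums (1 / 2 - (\<Sum>n. r n / ((2 + real n) * (3 + real n))))"
proof -
  \<comment> \<open>The case \<open>0\<close> encodes \<open>r (-1) = 1\<close>. So
    \<open>p 0 = 1 / 2\<close>, and \<open>p n - p (Suc n)\<close> is \<open>u n / (2 + n)\<close>
    plus \<open>r n / ((2 + n) * (3 + n))\<close>.\<close>
  define p where "p = (\<lambda>n. (case n of 0 \<Rightarrow> 1 | Suc m \<Rightarrow> r m) / real (n + 2))"
  have "(\<lambda>n. r n * (1 / real (n + 3))) \<longlonglongrightarrow> 0 * 0"
    by (intro tendsto_mult tail_sum_tendsto_0 LIMSEQ_ignore_initial_segment[OF lim_1_over_n])
  then have "(\<lambda>n. p (Suc n)) \<longlonglongrightarrow> 0" by (simp add: p_def add_ac)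
  then have "p \<longlonglongrightarrow> 0" by (simp only: filterlim_sequentially_Suc)
  from telescope_sums'[OF this]
  have "(\<lambda>n. p n - p (Suc n)) sums (1 / 2)" by (simp add: p_def)
  from sums_diff[OF this summable_sums[OF summable_tail_products]]
  have "(\<lambda>n. p n - p (Suc n) - r n / ((2 + real n) * (3 + real n)))
    sums (1 / 2 - (\<Sum>n. r n / ((2 + real n) * (3 + real n))))" .
  moreover have "p n - p (Suc n) - r n / ((2 + real n) * (3 + real n)) = u n / (2 + real n)" for n
  proof -
    have "r n / (3 + real n) + r n / ((2 + real n) * (3 + real n)) = r n / (2 + real n)"
      by (simp add: divide_simps) (simp add: algebra_simps)
    then show ?thesis
      by (cases n) (auto simp: p_def u_0 u_Suc diff_divide_distrib add_ac algebra_simps)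
  qed
  ultimately show ?thesis by simp
qed

section \<open>Two explicit terms of the recursion and bounds for the rest\<close>

definition K_tail :: "nat \<Rightarrow> real" where
  "K_tail s = (\<Sum>n. real s * (r (n + 2) + u (n + 2) * K (s + (n + 2))) / (real (s + (n + 2)) * real (s + (n + 2) + 1)))"

text \<open>Digit 0 leaves the starting value unchanged, so \<open>K s\<close> recurs on the right
  and the equation can be solved for it.\<close>

lemma K_split:
  assumes "0 < s"
  shows "K s = (r 0 + (1 - r 0) * K s) / (real s + 1)
    + real s * (r 1 + (r 0 - r 1) * K (s + 1)) / ((real s + 1) * (real s + 2)) + K_tail s"
proof -
  let ?t = "\<lambda>n. real s * (r n + u n * K (s + n)) / (real (s + n) * real (s + n + 1))"
  have "K s = ?t 0 + ?t 1 + K_tail s"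
    unfolding K_tail_def using sums_unique[OF K_sums[OF assms]]
      summable_split_two[OF sums_summable[OF K_sums[OF assms]]] by (simp only:)
  moreover have "?t 0 = (r 0 + (1 - r 0) * K s) / (real s + 1)"
    using assms by (simp add: u_0 add_ac)
  moreover have "?t 1 = real s * (r 1 + (r 0 - r 1) * K (s + 1)) / ((real s + 1) * (real s + 2))"
    using u_Suc[of 0] by (simp add: add_ac)
  ultimately show ?thesis by (simp only:)
qed

text \<open>Bounding each mean by two consecutive tails and regrouping gives
  \<open>r (n + 2)\<close> the weight \<open>\<omega> n + \<omega> (Suc n)\<close>, while
  \<open>r 1\<close> occurs only once, with weight \<open>\<omega> 0\<close>. The constant
  \<open>C\<close> compares these weights with \<open>1 / (n + 4)\<close>, the weight of
  \<open>r (n + 2)\<close> in the target series.\<close>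

lemma K_tail_le:
  fixes s :: nat and C :: real
  assumes s: "0 < s"
    and sm: "summable (\<lambda>n. r n / (2 + real n))"
    and C: "\<And>n. real s * (2 / ((real s + real n + 2) * (real s + real n + 4))) \<le> C / (real n + 4)"
  shows "K_tail s
    \<le> r 1 * (real s / (real (s + 2) * real (s + 3))) + C * (\<Sum>n. r (n + 2) / (2 + real (n + 2)))"
proof -
  define \<omega> where "\<omega> n = real s / (real (s + n + 2) * real (s + n + 3))" for n
  have \<omega>_pos: "\<omega> n \<ge> 0" for n by (simp add: \<omega>_def)
  have \<omega>2: "\<omega> n + \<omega> (Suc n) = real s * (2 / ((real s + real n + 2) * (real s + real n + 4)))" for n
    by (simp add: \<omega>_def divide_simps) (simp add: algebra_simps)
  have sm2: "summable (\<lambda>n. r (n + 2) / (2 + real (n + 2)))"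
    using sm by (subst summable_iff_shift)
  have bound: "r (n + 2) * (\<omega> n + \<omega> (Suc n)) \<le> C * (r (n + 2) / (2 + real (n + 2)))" for n
    using mult_left_mono[OF C[of n], of "r (n + 2)"] tail_pos[of "n + 2"]
    by (simp add: \<omega>2 mult_ac add_ac)
  have smb: "summable (\<lambda>n. C * (r (n + 2) / (2 + real (n + 2))))"
    using sm2 by (rule summable_mult)
  have sma: "summable (\<lambda>n. r (n + 2) * (\<omega> n + \<omega> (Suc n)))"
  proof (rule summable_comparison_test[OF _ smb], intro exI allI impI)
    fix n
    show "norm (r (n + 2) * (\<omega> n + \<omega> (Suc n))) \<le> C * (r (n + 2) / (2 + real (n + 2)))"
      using bound[of n] tail_pos[of "n + 2"] \<omega>_pos by (simp del: add_2_eq_Suc')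
  qed
  have sm': "summable (\<lambda>n. r (n + 2) * \<omega> (Suc n))" "summable (\<lambda>n. r (n + 2) * \<omega> n)"
    by (rule summable_comparison_test[OF _ sma], use tail_pos \<omega>_pos in
        \<open>auto intro!: exI[of _ 0] mult_left_mono simp: abs_mult less_imp_le\<close>)+
  then have sm1: "summable (\<lambda>n. r (Suc n) * \<omega> n)"
    using summable_Suc_iff[of "\<lambda>n. r (Suc n) * \<omega> n"] by simp
  have "(\<Sum>n. r (Suc n) * \<omega> n) = r 1 * \<omega> 0 + (\<Sum>n. r (n + 2) * \<omega> (Suc n))"
    using suminf_split_head[OF sm1] by simp
  moreover have "(\<Sum>n. r (n + 2) * (\<omega> n + \<omega> (Suc n)))
      = (\<Sum>n. r (n + 2) * \<omega> n) + (\<Sum>n. r (n + 2) * \<omega> (Suc n))"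
    unfolding distrib_left by (rule suminf_add[OF sm'(2,1), symmetric])
  moreover have "(\<Sum>n. (r (Suc n) + r (n + 2)) * \<omega> n)
      = (\<Sum>n. r (Suc n) * \<omega> n) + (\<Sum>n. r (n + 2) * \<omega> n)"
    unfolding distrib_right by (rule suminf_add[OF sm1 sm'(2), symmetric])
  ultimately have "(\<Sum>n. (r (Suc n) + r (n + 2)) * \<omega> n)
      = r 1 * \<omega> 0 + (\<Sum>n. r (n + 2) * (\<omega> n + \<omega> (Suc n)))" by simp
  also have "(\<Sum>n. r (n + 2) * (\<omega> n + \<omega> (Suc n))) \<le> (\<Sum>n. C * (r (n + 2) / (2 + real (n + 2))))"
    by (rule suminf_le[OF bound sma smb])
  also have "\<dots> = C * (\<Sum>n. r (n + 2) / (2 + real (n + 2)))"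
    by (rule suminf_mult[OF sm2])
  finally have *: "(\<Sum>n. (r (Suc n) + r (n + 2)) * \<omega> n)
      \<le> r 1 * \<omega> 0 + C * (\<Sum>n. r (n + 2) / (2 + real (n + 2)))" by simp
  have "K_tail s
      \<le> (\<Sum>n. (r (Suc n) + r (n + 2)) * \<omega> n)"
    unfolding K_tail_def
  proof (rule suminf_le)
    show "summable (\<lambda>n. real s * (r (n + 2) + u (n + 2) * K (s + (n + 2))) / (real (s + (n + 2)) * real (s + (n + 2) + 1)))"
      using summable_ignore_initial_segment[OF sums_summable[OF K_sums[OF s]], of 2] .
    show "summable (\<lambda>n. (r (Suc n) + r (n + 2)) * \<omega> n)"
      unfolding distrib_right by (rule summable_add[OF sm1 sm'(2)])
    fix n
    have "r (Suc (Suc n)) + u (Suc (Suc n)) * K (s + (n + 2)) \<le> r (Suc n) + r (Suc (Suc n))"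
      using K_bounds[of "s + (n + 2)"] by (intro affine_bounds(3)) auto
    from mult_right_mono[OF this \<omega>_pos[of n]]
    show "real s * (r (n + 2) + u (n + 2) * K (s + (n + 2))) / (real (s + (n + 2)) * real (s + (n + 2) + 1))
        \<le> (r (Suc n) + r (n + 2)) * \<omega> n"
      by (simp add: \<omega>_def add_ac mult_ac)
  qed
  also note *
  finally show ?thesis by (simp add: \<omega>_def)
qed

lemma K_tail_nonneg:
  assumes "0 < s"
  shows "0 \<le> K_tail s"
  unfolding K_tail_def
proof (rule suminf_nonneg)
  show "summable (\<lambda>n. real s * (r (n + 2) + u (n + 2) * K (s + (n + 2))) / (real (s + (n + 2)) * real (s + (n + 2) + 1)))"
    using summable_ignore_initial_segment[OF sums_summable[OF K_sums[OF assms]], of 2] .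
  show "0 \<le> real s * (r (n + 2) + u (n + 2) * K (s + (n + 2))) / (real (s + (n + 2)) * real (s + (n + 2) + 1))" for n
    using K_bounds[of "s + (n + 2)"] by (intro divide_nonneg_nonneg mult_nonneg_nonneg affine_bounds(1)) auto
qed

text \<open>The case of a finite right-hand side: the recursions at 1 and 2 supply the data for
  \<open>two_step_estimate\<close>.\<close>

lemma K_1_estimate:
  assumes sm: "summable (\<lambda>n. r n / (2 + real n))"
  shows "K 1 * (1 - (\<Sum>n. u n / (2 + real n))) \<le> (\<Sum>n. r n / (2 + real n))"
proof -
  define a b I E L where "a = r 0" and "b = r 1" and "I = K 1" and "E = K 2" and "L = K 3"
  define T1 where "T1 = K_tail 1"
  define T2 where "T2 = K_tail 2"
  \<comment> \<open>The factor 2 here and in \<open>V\<close> anticipates doubling the claim: twice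
    the right side is \<open>a + 2 * b / 3 + W\<close>, and twice the factor of \<open>K 1\<close>
    is \<open>1 + a / 3 + b / 6 + V\<close>.\<close>
  define W where "W = 2 * (\<Sum>n. r (n + 2) / (2 + real (n + 2)))"
  define V where "V = 2 * (\<Sum>n. r (n + 2) / ((2 + real (n + 2)) * (3 + real (n + 2))))"
  have a: "0 < a" "a < 1" and b: "0 < b" "b < 1"
    using tail_pos tail_less_1 by (auto simp: a_def b_def)
  have I: "0 \<le> I" "I \<le> 1" and E: "0 \<le> E" "E \<le> 1" and L: "0 \<le> L" "L \<le> 1"
    using K_bounds by (auto simp: I_def E_def L_def)
  have I_eq: "I = (a + (1 - a) * I) / 2 + (b + (a - b) * E) / 6 + T1"
  proof -
    have "real 1 * q / ((real 1 + 1) * (real 1 + 2)) = q / 6" "real 1 + 1 = 2" "1 + 1 = (2 :: nat)" for q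
      by simp_all
    then show ?thesis using K_split[of 1] unfolding I_def E_def T1_def a_def b_def by (simp only: zero_less_one)
  qed
  have E_eq: "E = (a + (1 - a) * E) / 3 + (b + (a - b) * L) / 6 + T2"
  proof -
    have "real 2 * q / ((real 2 + 1) * (real 2 + 2)) = q / 6" "real 2 + 1 = 3" "2 + 1 = (3 :: nat)" for q
      by simp_all
    then show ?thesis using K_split[of 2] unfolding E_def L_def T2_def a_def b_def by (simp only: zero_less_numeral)
  qed
  have T1: "0 \<le> T1" "T1 \<le> b / 12 + 4 * W / 15"
  proof -
    show "0 \<le> T1" unfolding T1_def by (rule K_tail_nonneg) simp
    have "T1 \<le> r 1 * (real 1 / (real (1 + 2) * real (1 + 3))) + 8 / 15 * (\<Sum>n. r (n + 2) / (2 + real (n + 2)))"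
      unfolding T1_def
    proof (rule K_tail_le[OF _ sm])
      fix n :: nat
      \<comment> \<open>The constant \<open>8 / 15\<close> is the maximum of
        \<open>2 * (n + 4) / ((n + 3) * (n + 5))\<close>, attained at \<open>n = 0\<close>.\<close>
      have "15 * (real n + 4) * 2 \<le> 8 * ((real n + 3) * (real n + 5))" by (simp add: algebra_simps)
      then show "real 1 * (2 / ((real 1 + real n + 2) * (real 1 + real n + 4))) \<le> 8 / 15 / (real n + 4)"
        by (simp add: divide_simps) (simp add: algebra_simps)
    qed simp
    then show "T1 \<le> b / 12 + 4 * W / 15" by (simp add: b_def W_def)
  qed
  have T2: "0 \<le> T2" "T2 \<le> b / 10 + W / 3"
  proof -
    show "0 \<le> T2" unfolding T2_def by (rule K_tail_nonneg) simp
    have "T2 \<le> r 1 * (real 2 / (real (2 + 2) * real (2 + 3))) + 2 / 3 * (\<Sum>n. r (n + 2) / (2 + real (n + 2)))"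
      unfolding T2_def
    proof (rule K_tail_le[OF _ sm])
      fix n :: nat
      \<comment> \<open>The ratio of the two weights is \<open>4 / (n + 6)\<close>, which equals
        \<open>2 / 3\<close> at \<open>n = 0\<close>.\<close>
      show "real 2 * (2 / ((real 2 + real n + 2) * (real 2 + real n + 4))) \<le> 2 / 3 / (real n + 4)"
        by (simp add: divide_simps) (simp add: algebra_simps)
    qed simp
    then show "T2 \<le> b / 10 + W / 3" by (simp add: b_def W_def)
  qed
  have sm2: "summable (\<lambda>n. r (n + 2) / (2 + real (n + 2)))"
    using sm by (subst summable_iff_shift)
  have smV: "summable (\<lambda>n. r (n + 2) / ((2 + real (n + 2)) * (3 + real (n + 2))))"
    using summable_ignore_initial_segment[OF summable_tail_products, of 2] .
  have W: "0 \<le> W"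
    unfolding W_def using tail_pos by (intro mult_nonneg_nonneg suminf_nonneg[OF sm2]) (auto simp: less_imp_le)
  have "(\<Sum>n. r (n + 2) / ((2 + real (n + 2)) * (3 + real (n + 2))))
      \<le> (\<Sum>n. 1 / 5 * (r (n + 2) / (2 + real (n + 2))))"
  proof (rule suminf_le[OF _ smV summable_mult[OF sm2]])
    fix n
    have "r (n + 2) / (2 + real (n + 2)) / (3 + real (n + 2)) \<le> r (n + 2) / (2 + real (n + 2)) / 5"
      using tail_pos[of "n + 2"] by (intro divide_left_mono) auto
    then show "r (n + 2) / ((2 + real (n + 2)) * (3 + real (n + 2))) \<le> 1 / 5 * (r (n + 2) / (2 + real (n + 2)))"
      by (simp only: divide_divide_eq_left mult_1 times_divide_eq_left)
  qed
  then have V: "V \<le> W / 5" unfolding suminf_mult[OF sm2] by (simp add: V_def W_def)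
  have B: "(\<Sum>n. r n / (2 + real n)) = a / 2 + b / 3 + W / 2"
    unfolding summable_split_two[OF sm] by (simp add: a_def b_def W_def)
  have A: "1 - (\<Sum>n. u n / (2 + real n)) = 1 / 2 + a / 6 + b / 12 + V / 2"
    using sums_unique[OF weighted_sum_by_parts] summable_split_two[OF summable_tail_products]
    by (simp add: a_def b_def V_def)
  have "I * (1 + a / 3 + b / 6 + V) \<le> a + 2 * b / 3 + W"
    by (rule two_step_estimate[OF a b(1) I E L T1 T2 W V I_eq E_eq])
  then show ?thesis unfolding A B I_def[symmetric] by (simp add: algebra_simps)
qed

section \<open>Positivity of the factor and return to \<open>f\<close>\<close>

lemma weighted_sum_less_1: "(\<Sum>n. u n / (2 + real n)) < 1"
proof -
  have "0 \<le> (\<Sum>n. r n / ((2 + real n) * (3 + real n)))"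
    using tail_pos by (intro suminf_nonneg summable_tail_products) (auto simp: less_imp_le)
  \<comment> \<open>Summation by parts even bounds the sum by \<open>1 / 2\<close>.\<close>
  then show ?thesis using sums_unique[OF weighted_sum_by_parts] by simp
qed

text \<open>The value 0 at \<open>x = 0\<close> makes the passage from the closed to the half-open
  interval exact at every point, not only almost everywhere.\<close>

lemma indicator_E_function:
  "indicator {0..1} x *\<^sub>R E_function u x = indicator {0<..1} x *\<^sub>R F 1 x"
  by (auto simp: indicator_def E_function_def F_def E_digits_eq)

lemma set_integrable_E_function: "set_integrable lebesgue {0..1} (E_function u)"
proof -
  have "integrable lborel (\<lambda>x. indicator {0<..1} x *\<^sub>R F 1 x)"
    using set_integrable_F unfolding set_integrable_def .
  then show ?thesis
    unfolding set_integrable_def indicator_E_function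
    by (subst integrable_completion) (auto dest: borel_measurable_integrable)
qed

lemma set_integral_E_function: "(LINT x:{0..1}|lebesgue. E_function u x) = K 1"
  unfolding set_lebesgue_integral_def indicator_E_function K_def
  by (subst integral_completion) (auto simp: set_lebesgue_integral_def)

end

theorem theorem9:
  fixes u :: "nat \<Rightarrow> real"
  assumes "u sums 1"
    and "\<And>n. \<bar>u n\<bar> < 1"
    and "\<And>n. 0 < tail_sum u n"
    and "\<And>n. tail_sum u n < 1"
  shows "set_integrable lebesgue {0..1} (E_function u)
    \<and> summable (\<lambda>n. u n / (2 + real n))
    \<and> (\<Sum>n. u n / (2 + real n)) \<noteq> 1
    \<and> ereal (LINT x:{0..1}|lebesgue. E_function u x)
        \<le> ereal (inverse (1 - (\<Sum>n. u n / (2 + real n))))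
            * (\<Sum>n. ereal (tail_sum u n / (2 + real n)))"
proof -
  interpret signed_digit_weights u by unfold_locales (fact assms)+
  define A where "A = (\<Sum>n. u n / (2 + real n))"
  have A: "A < 1" unfolding A_def by (rule weighted_sum_less_1)
  have nonneg: "0 \<le> r n / (2 + real n)" for n using tail_pos[of n] by simp
  have "ereal (K 1) \<le> ereal (inverse (1 - A)) * (\<Sum>n. ereal (r n / (2 + real n)))"
  proof (cases "summable (\<lambda>n. r n / (2 + real n))")
    case True
    have "K 1 \<le> inverse (1 - A) * (\<Sum>n. r n / (2 + real n))"
      using K_1_estimate[OF True] A
      by (simp add: A_def[symmetric] pos_le_divide_eq inverse_eq_divide del: One_nat_def)
    moreover have "(\<Sum>n. ereal (r n / (2 + real n))) = ereal (\<Sum>n. r n / (2 + real n))"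
      using True by (intro sums_unique[symmetric]) (simp add: sums_ereal summable_sums)
    ultimately show ?thesis by simp
  next
    case False
    \<comment> \<open>Nonnegative terms without a finite sum add up to infinity in
      \<open>ereal\<close>, and multiplication by the positive \<open>inverse (1 - A)\<close> keeps
      it infinite.\<close>
    then have "(\<Sum>n. ereal (r n / (2 + real n))) = \<infinity>"
      using summable_ereal[of "\<lambda>n. r n / (2 + real n)", OF nonneg] by blast
    then show ?thesis using A by simp
  qed
  then show ?thesis
    using set_integrable_E_function sums_summable[OF weighted_sum_by_parts] A
    by (simp add: set_integral_E_function A_def)
qed

end
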